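(* Let $1<p<\infty$ and let $g$ be an outer function in $H^p$ such that $|g|^p$ is a Muckenhoupt $(A_p)$ weight on $\mathbb{T}$. Let $I$ be an inner function with spectrum $\sigma(I)$. Then $$\{\overline{\lambda}:\lambda\in\sigma(I)\}\subset \sigma_{ap}\bigl(B|_{K^p_I(|g|^p)}\bigr).$$
   Context: $\mathbb{D}$ is the open unit disk, $\mathbb{T}$ the unit circle, $H^p$ the Hardy space of $\mathbb{D}$; $\operatorname{clos}$ denotes closure. For an outer function $g\in H^p$, $H^p(|g|^p)=\{f \text{ holomorphic in }\mathbb{D}: fg\in H^p\}$ with norm $\|f\|_{|g|^p}=\|fg\|_{H^p}$, and $H^p_0(|g|^p)=\{\psi\in H^p(|g|^p):\psi(0)=0\}$. For an inner function $I$, $K^p_I(|g|^p)$ is the set of $f\in H^p(|g|^p)$ for which there is $\psi\in H^p_0(|g|^p)$ with $f=I\overline{\psi}$ a.e. on $\mathbb{T}$ (boundary values). The spectrum of $I$ is $\sigma(I)=\{\lambda\in\operatorname{clos}\mathbb{D}:\liminf_{z\to\lambda,\,z\in\mathbb{D}}|I(z)|=0\}$. $B$ is the backward shift $Bf(z)=(f(z)-f(0))/z$; it leaves $K^p_I(|g|^p)$ invariant. For an operator $T$, the approximate point spectrum is $\sigma_{ap}(T)=\{\lambda\in\mathbb{C}:\exists (f_n)_n,\ \|f_n\|=1,\ (\lambda-T)f_n\to0\}$. A weight $w$ on $\mathbb{T}$ is a Muckenhoupt $(A_p)$ weight if $\sup_{J}\bigl(\frac1{|J|}\int_J w\,dx\bigr)\bigl(\frac1{|J|}\int_J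 w^{-1/(p-1)}dx\bigr)^{p-1}<\infty$, the supremum being over all subarcs $J$ of $\mathbb{T}$. *)

theory Defs
  imports "HOL-Complex_Analysis.Complex_Analysis"
begin

text \<open>
  Functions on the open unit disk are total functions on the complex numbers of which only the
  values on \<^term>\<open>ball (0::complex) 1\<close> matter. Points of the unit circle are written
  \<^term>\<open>cis t\<close>; since \<^const>\<open>cis\<close> has period \<^term>\<open>2 * pi\<close>, ``almost everywhere on the
  circle'' is expressed as ``for Lebesgue-almost every real t''.
\<close>

definition has_radial_limit :: "(complex \<Rightarrow> complex) \<Rightarrow> complex \<Rightarrow> complex \<Rightarrow> bool" where
  "has_radial_limit f \<zeta> l \<longleftrightarrow> ((\<lambda>r. f (complex_of_real r * \<zeta>)) \<longlongrightarrow> l) (at_left 1)"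

text \<open>Meaningful only where the radial limit exists, which for Hardy space functions is almost
  everywhere.\<close>

definition radial_limit :: "(complex \<Rightarrow> complex) \<Rightarrow> complex \<Rightarrow> complex" where
  "radial_limit f \<zeta> = Lim (at_left 1) (\<lambda>r. f (complex_of_real r * \<zeta>))"

definition integral_mean :: "real \<Rightarrow> (complex \<Rightarrow> complex) \<Rightarrow> real \<Rightarrow> real" where
  "integral_mean p f r =
     1 / (2 * pi) * (LINT t:{0..2 * pi}|lborel. norm (f (complex_of_real r * cis t)) powr p)"

definition hardy_space :: "real \<Rightarrow> (complex \<Rightarrow> complex) set" where
  "hardy_space p =
     {f. f holomorphic_on ball 0 1 \<and> bdd_above (integral_mean p f ` {0..<1})}"

definition hardy_norm :: "real \<Rightarrow> (complex \<Rightarrow> complex) \<Rightarrow> real" where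
  "hardy_norm p f = (SUP r\<in>{0..<1}. integral_mean p f r) powr (1 / p)"

definition outer_function :: "(complex \<Rightarrow> complex) \<Rightarrow> bool" where
  "outer_function g \<longleftrightarrow>
     (\<exists>c \<phi>. norm c = 1 \<and>
        (\<forall>\<zeta>\<in>sphere 0 1. (0::real) < \<phi> \<zeta>) \<and>
        set_integrable lborel {0..2 * pi} (\<lambda>t. ln (\<phi> (cis t))) \<and>
        (\<forall>z\<in>ball 0 1.
           g z = c * exp (1 / (2 * complex_of_real pi) *
             (LINT t:{0..2 * pi}|lborel.
                (cis t + z) / (cis t - z) * complex_of_real (ln (\<phi> (cis t)))))))"

definition inner_function :: "(complex \<Rightarrow> complex) \<Rightarrow> bool" where
  "inner_function I \<longleftrightarrow>
     I holomorphic_on ball 0 1 \<and>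
     (\<forall>z\<in>ball 0 1. norm (I z) \<le> 1) \<and>
     (AE t in lborel. \<exists>l. has_radial_limit I (cis t) l \<and> norm l = 1)"

text \<open>The spectrum is a subset of the closed disk, where the filter in the limit inferior is
  nontrivial.\<close>

definition inner_spectrum :: "(complex \<Rightarrow> complex) \<Rightarrow> complex set" where
  "inner_spectrum I =
     {l \<in> closure (ball 0 1). Liminf (at l within ball 0 1) (\<lambda>z. ereal (norm (I z))) = 0}"

text \<open>
  The Bochner integral of a non-integrable function is 0, so the finiteness of the two integrals,
  which in the usual definition is part of the finiteness of the supremum, is required explicitly.
  Likewise positivity almost everywhere is explicit because \<^term>\<open>0 powr a = (0::real)\<close> for
  negative a too, where the usual convention gives infinity. Subarcs are the images under
  \<^const>\<open>cis\<close> of intervals of length at most \<^term>\<open>2 * pi\<close>.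
\<close>

definition muckenhoupt_weight :: "real \<Rightarrow> (complex \<Rightarrow> real) \<Rightarrow> bool" where
  "muckenhoupt_weight p w \<longleftrightarrow>
     (AE t in lborel. 0 < w (cis t)) \<and>
     set_integrable lborel {0..2 * pi} (\<lambda>t. w (cis t)) \<and>
     set_integrable lborel {0..2 * pi} (\<lambda>t. w (cis t) powr (- 1 / (p - 1))) \<and>
     bdd_above {(1 / (b - a) * (LINT t:{a..b}|lborel. w (cis t))) *
                (1 / (b - a) * (LINT t:{a..b}|lborel. w (cis t) powr (- 1 / (p - 1)))) powr (p - 1)
                | a b. a < b \<and> b \<le> a + 2 * pi}"

text \<open>The second argument is the outer function g whose boundary values define the weight.\<close>

definition weighted_hardy_space :: "real \<Rightarrow> (complex \<Rightarrow> complex) \<Rightarrow> (complex \<Rightarrow> complex) set" where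
  "weighted_hardy_space p g =
     {f. f holomorphic_on ball 0 1 \<and> (\<lambda>z. f z * g z) \<in> hardy_space p}"

definition weighted_hardy_norm :: "real \<Rightarrow> (complex \<Rightarrow> complex) \<Rightarrow> (complex \<Rightarrow> complex) \<Rightarrow> real" where
  "weighted_hardy_norm p g f = hardy_norm p (\<lambda>z. f z * g z)"

definition weighted_hardy_space0 :: "real \<Rightarrow> (complex \<Rightarrow> complex) \<Rightarrow> (complex \<Rightarrow> complex) set" where
  "weighted_hardy_space0 p g = {\<psi> \<in> weighted_hardy_space p g. \<psi> 0 = 0}"

definition model_space ::
    "real \<Rightarrow> (complex \<Rightarrow> complex) \<Rightarrow> (complex \<Rightarrow> complex) \<Rightarrow> (complex \<Rightarrow> complex) set" where
  "model_space p g I =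
     {f \<in> weighted_hardy_space p g.
        \<exists>\<psi>\<in>weighted_hardy_space0 p g.
          AE t in lborel. \<exists>a b c.
            has_radial_limit f (cis t) a \<and> has_radial_limit I (cis t) b \<and>
            has_radial_limit \<psi> (cis t) c \<and> a = b * cnj c}"

text \<open>The value at 0 is the one that removes the singularity.\<close>

definition backward_shift :: "(complex \<Rightarrow> complex) \<Rightarrow> complex \<Rightarrow> complex" where
  "backward_shift f z = (if z = 0 then deriv f 0 else (f z - f 0) / z)"

text \<open>Approximate point spectrum of the restriction of T to the T-invariant space V, with norm N.\<close>

definition approx_point_spectrum ::
    "(complex \<Rightarrow> complex) set \<Rightarrow> ((complex \<Rightarrow> complex) \<Rightarrow> real) \<Rightarrow>
     ((complex \<Rightarrow> complex) \<Rightarrow> (complex \<Rightarrow> complex)) \<Rightarrow> complex set" where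
  "approx_point_spectrum V N T =
     {l. \<exists>f :: nat \<Rightarrow> complex \<Rightarrow> complex.
           (\<forall>n. f n \<in> V \<and> N (f n) = 1) \<and>
           (\<lambda>n. N (\<lambda>z. l * f n z - T (f n) z)) \<longlonglongrightarrow> 0}"

end

theory Submission
  imports Defs
begin

text \<open>
  The reproducing kernels of the model space are approximate eigenvectors. For \<open>a\<close> in the disk put
  \<open>k\<^sub>a z = (1 - cnj (I a) * I z) / (1 - cnj a * z)\<close>. On the circle \<open>I * cnj k\<^sub>a\<close> agrees with
  \<open>z * (I z - I a) / (z - a)\<close>, which is bounded and vanishes at 0, so \<open>k\<^sub>a\<close> belongs to the model space
  (\<open>kernel_in_model_space\<close>): products of \<open>g\<close> with bounded holomorphic functions stay in the Hardy
  space. A direct computation (\<open>kernel_almost_eigenvector\<close>) gives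
  \<open>(cnj a - B) k\<^sub>a = cnj (I a) * B I\<close>.

  If \<open>l\<close> is in the spectrum of \<open>I\<close>, there are points \<open>a\<^sub>n\<close> of the disk with \<open>a\<^sub>n \<longlonglongrightarrow> l\<close> and
  \<open>I a\<^sub>n \<longlonglongrightarrow> 0\<close>. The right-hand side above then tends to 0 in norm, and so does the normalised
  one provided that the norms of the kernels stay away from 0. They do, because the norm dominates
  evaluation at the origin: \<open>k\<^sub>a 0 * g 0 = (1 - cnj (I a) * I 0) * g 0\<close> tends to \<open>g 0\<close>, and an outer
  function has no zeros. Replacing the eigenvalue \<open>cnj a\<^sub>n\<close> by its limit \<open>cnj l\<close> costs
  \<open>\<bar>l - a\<^sub>n\<bar>\<close> times a unit vector.

  Nothing here depends on whether \<open>l\<close> lies on the circle or is a zero of \<open>I\<close> inside the disk, so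
  interior and boundary points of the spectrum need no separate treatment.
\<close>

section \<open>Integral means and the Hardy norm\<close>

lemma bounded_image_iff: "bounded (f ` S) \<longleftrightarrow> (\<exists>M. \<forall>x\<in>S. norm (f x) \<le> M)"
  by (simp add: bounded_iff)

lemma circle_point_in_disk:
  assumes "r \<in> {0..<1}"
  shows "complex_of_real r * cis t \<in> ball 0 1"
  using assms by (simp add: norm_mult)

lemma integrable_on_circle:
  assumes f: "f holomorphic_on ball 0 1" and r: "r \<in> {0..<1}" and p: "0 < p"
  shows "set_integrable lborel {0..2 * pi} (\<lambda>t. norm (f (complex_of_real r * cis t)) powr p)"
proof -
  have "continuous_on {0..2 * pi} (\<lambda>t. f (complex_of_real r * cis t))"
    by (rule continuous_on_compose2[OF holomorphic_on_imp_continuous_on[OF f]])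
       (use circle_point_in_disk[OF r] in \<open>auto intro!: continuous_intros\<close>)
  then have "continuous_on {0..2 * pi} (\<lambda>t. norm (f (complex_of_real r * cis t)) powr p)"
    using p by (intro continuous_on_powr' continuous_intros) auto
  then show ?thesis
    by (rule borel_integrable_atLeastAtMost')
qed

lemma integral_mean_nonneg: "0 \<le> integral_mean p f r"
  unfolding integral_mean_def set_lebesgue_integral_def
  by (intro mult_nonneg_nonneg Bochner_Integration.integral_nonneg) auto

lemma integral_mean_zero: "integral_mean p f 0 = norm (f 0) powr p"
  by (simp add: integral_mean_def set_integral_const)

lemma integral_mean_mono:
  assumes h: "h holomorphic_on ball 0 1" and f: "f holomorphic_on ball 0 1"
    and r: "r \<in> {0..<1}" and p: "0 < p" and M: "0 \<le> M"
    and le: "\<And>z. z \<in> ball 0 1 \<Longrightarrow> norm (h z) \<le> M * norm (f z)"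
  shows "integral_mean p h r \<le> M powr p * integral_mean p f r"
proof -
  have "(LINT t:{0..2 * pi}|lborel. norm (h (complex_of_real r * cis t)) powr p)
      \<le> (LINT t:{0..2 * pi}|lborel. M powr p * norm (f (complex_of_real r * cis t)) powr p)"
  proof (rule set_integral_mono)
    fix t
    have "norm (h (complex_of_real r * cis t)) powr p
        \<le> (M * norm (f (complex_of_real r * cis t))) powr p"
      using p by (intro powr_mono2 le circle_point_in_disk[OF r]) auto
    then show "norm (h (complex_of_real r * cis t)) powr p
        \<le> M powr p * norm (f (complex_of_real r * cis t)) powr p"
      using M by (simp add: powr_mult)
  qed (use integrable_on_circle[OF h r p] integrable_on_circle[OF f r p] in auto)
  then show ?thesis
    by (simp add: integral_mean_def divide_right_mono)
qed

text \<open>The exact constant is irrelevant for convergence to 0, so the pointwise bound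
  \<open>\<bar>u + v\<bar> \<le> 2 * max \<bar>u\<bar> \<bar>v\<bar>\<close> replaces Minkowski's inequality.\<close>

lemma integral_mean_add:
  assumes u: "u holomorphic_on ball 0 1" and v: "v holomorphic_on ball 0 1"
    and r: "r \<in> {0..<1}" and p: "0 < p"
  shows "integral_mean p (\<lambda>z. u z + v z) r
      \<le> 2 powr p * (integral_mean p u r + integral_mean p v r)"
proof -
  have pointwise: "norm (x + y) powr p \<le> 2 powr p * (norm x powr p + norm y powr p)"
    for x y :: complex
  proof -
    have "norm (x + y) powr p \<le> (2 * max (norm x) (norm y)) powr p"
      using p norm_triangle_ineq[of x y] by (intro powr_mono2) auto
    also have "\<dots> = 2 powr p * max (norm x) (norm y) powr p"
      by (simp add: powr_mult)
    also have "\<dots> \<le> 2 powr p * (norm x powr p + norm y powr p)"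
      by (intro mult_left_mono) (auto simp: max_def)
    finally show ?thesis .
  qed
  note intu = integrable_on_circle[OF u r p] and intv = integrable_on_circle[OF v r p]
  have uv: "(\<lambda>z. u z + v z) holomorphic_on ball 0 1"
    by (intro holomorphic_intros u v)
  have "(LINT t:{0..2 * pi}|lborel.
          norm (u (complex_of_real r * cis t) + v (complex_of_real r * cis t)) powr p)
      \<le> (LINT t:{0..2 * pi}|lborel. 2 powr p * (norm (u (complex_of_real r * cis t)) powr p
            + norm (v (complex_of_real r * cis t)) powr p))"
    by (rule set_integral_mono)
       (use integrable_on_circle[OF uv r p] intu intv pointwise in \<open>auto intro: set_integral_add\<close>)
  also have "\<dots> = 2 powr p * ((LINT t:{0..2 * pi}|lborel. norm (u (complex_of_real r * cis t)) powr p)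
            + (LINT t:{0..2 * pi}|lborel. norm (v (complex_of_real r * cis t)) powr p))"
    using intu intv by (simp add: set_integral_add)
  finally show ?thesis
    by (simp add: integral_mean_def field_simps)
qed

lemma integral_mean_le_hardy_norm:
  assumes f: "f \<in> hardy_space p" and r: "r \<in> {0..<1}" and p: "0 < p"
  shows "integral_mean p f r \<le> hardy_norm p f powr p"
proof -
  have "bdd_above (integral_mean p f ` {0..<1})"
    using f by (simp add: hardy_space_def)
  then have "integral_mean p f r \<le> (SUP r\<in>{0..<1}. integral_mean p f r)"
    by (intro cSUP_upper r)
  with integral_mean_nonneg[of p f r] p show ?thesis
    by (simp add: hardy_norm_def powr_powr)
qed

lemma hardy_norm_nonneg: "0 \<le> hardy_norm p f"
  by (simp add: hardy_norm_def)

lemma hardy_norm_leI: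
  assumes p: "0 < p" and C: "0 \<le> C"
    and le: "\<And>r. r \<in> {0..<1} \<Longrightarrow> integral_mean p f r \<le> C powr p"
  shows "hardy_norm p f \<le> C"
proof -
  have bdd: "bdd_above (integral_mean p f ` {0..<1})"
    using le by (intro bdd_aboveI2)
  have "integral_mean p f 0 \<le> (SUP r\<in>{0..<1}. integral_mean p f r)"
    by (rule cSUP_upper[OF _ bdd]) auto
  then have "0 \<le> (SUP r\<in>{0..<1}. integral_mean p f r)"
    using integral_mean_nonneg[of p f 0] by linarith
  moreover have "(SUP r\<in>{0..<1}. integral_mean p f r) \<le> C powr p"
    using le by (intro cSUP_least) auto
  ultimately have "hardy_norm p f \<le> (C powr p) powr (1 / p)"
    unfolding hardy_norm_def using p by (intro powr_mono2) auto
  with p C show ?thesis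
    by (simp add: powr_powr)
qed

lemma hardy_space_mono:
  assumes h: "h holomorphic_on ball 0 1" and f: "f \<in> hardy_space p" and p: "0 < p" and M: "0 \<le> M"
    and le: "\<And>z. z \<in> ball 0 1 \<Longrightarrow> norm (h z) \<le> M * norm (f z)"
  shows "h \<in> hardy_space p" and "hardy_norm p h \<le> M * hardy_norm p f"
proof -
  have "f holomorphic_on ball 0 1"
    using f by (simp add: hardy_space_def)
  then have "integral_mean p h r \<le> M powr p * hardy_norm p f powr p" if "r \<in> {0..<1}" for r
    using integral_mean_mono[OF h _ that p M le] integral_mean_le_hardy_norm[OF f that p]
    by (meson mult_left_mono order_trans powr_ge_zero)
  then have *: "integral_mean p h r \<le> (M * hardy_norm p f) powr p" if "r \<in> {0..<1}" for r
    using that M by (simp add: powr_mult hardy_norm_nonneg)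
  then have "bdd_above (integral_mean p h ` {0..<1})"
    by (rule bdd_aboveI2)
  then show "h \<in> hardy_space p"
    using h by (simp add: hardy_space_def)
  show "hardy_norm p h \<le> M * hardy_norm p f"
    using * p M hardy_norm_nonneg by (intro hardy_norm_leI) auto
qed

lemma hardy_space_scale:
  assumes f: "f \<in> hardy_space p" and p: "0 < p"
  shows "(\<lambda>z. s * f z) \<in> hardy_space p"
    and "hardy_norm p (\<lambda>z. s * f z) = norm s * hardy_norm p f"
proof -
  have hol: "f holomorphic_on ball 0 1"
    using f by (simp add: hardy_space_def)
  then have hols: "(\<lambda>z. s * f z) holomorphic_on ball 0 1"
    by (intro holomorphic_intros)
  show mem: "(\<lambda>z. s * f z) \<in> hardy_space p"
    using hardy_space_mono(1)[OF hols f p, of "norm s"] by (simp add: norm_mult)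
  have le: "hardy_norm p (\<lambda>z. s * f z) \<le> norm s * hardy_norm p f"
    using hardy_space_mono(2)[OF hols f p, of "norm s"] by (simp add: norm_mult)
  show "hardy_norm p (\<lambda>z. s * f z) = norm s * hardy_norm p f"
  proof (cases "s = 0")
    case True
    with le hardy_norm_nonneg[of p "\<lambda>z. s * f z"] show ?thesis
      by simp
  next
    case False
    have "hardy_norm p f \<le> norm (1 / s) * hardy_norm p (\<lambda>z. s * f z)"
      using False by (intro hardy_space_mono(2)[OF hol mem p]) (auto simp: norm_mult norm_divide)
    with le False show ?thesis
      by (simp add: norm_divide field_simps)
  qed
qed

text \<open>Taking \<open>p\<close>-th roots, the factor is \<open>2 * 2 powr (1 / p)\<close>, at most 4 because \<open>p \<ge> 1\<close>.\<close>

lemma hardy_norm_add: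
  assumes u: "u \<in> hardy_space p" and v: "v \<in> hardy_space p" and p: "1 \<le> p"
  shows "hardy_norm p (\<lambda>z. u z + v z) \<le> 4 * (hardy_norm p u + hardy_norm p v)"
proof (rule hardy_norm_leI)
  let ?u = "hardy_norm p u" and ?v = "hardy_norm p v"
  fix r :: real assume r: "r \<in> {0..<1}"
  have "integral_mean p (\<lambda>z. u z + v z) r \<le> 2 powr p * (integral_mean p u r + integral_mean p v r)"
    using u v r p by (intro integral_mean_add) (auto simp: hardy_space_def)
  also have "\<dots> \<le> 2 powr p * (?u powr p + ?v powr p)"
    using integral_mean_le_hardy_norm[OF u r] integral_mean_le_hardy_norm[OF v r] p
    by (intro mult_left_mono add_mono) auto
  also have "\<dots> \<le> 2 powr p * (2 powr 1 * (?u + ?v) powr p)"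
    using powr_mono2[of p ?u "?u + ?v"] powr_mono2[of p ?v "?u + ?v"] p
      hardy_norm_nonneg[of p u] hardy_norm_nonneg[of p v]
    by (intro mult_left_mono) auto
  also have "\<dots> \<le> 2 powr p * (2 powr p * (?u + ?v) powr p)"
    using p by (intro mult_left_mono mult_right_mono powr_mono) auto
  also have "\<dots> = (2 * (2 * (?u + ?v))) powr p"
    using hardy_norm_nonneg[of p u] hardy_norm_nonneg[of p v] by (simp only: powr_mult)
  finally show "integral_mean p (\<lambda>z. u z + v z) r \<le> (4 * (?u + ?v)) powr p"
    by simp
qed (use p hardy_norm_nonneg[of p u] hardy_norm_nonneg[of p v] in auto)

text \<open>Evaluation at the origin is the integral mean over the degenerate circle of radius 0.\<close>

lemma norm_at_origin_le_hardy_norm: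
  assumes f: "f \<in> hardy_space p" and p: "0 < p"
  shows "norm (f 0) \<le> hardy_norm p f"
proof -
  have "norm (f 0) powr p \<le> hardy_norm p f powr p"
    using integral_mean_le_hardy_norm[OF f _ p, of 0] by (simp add: integral_mean_zero)
  then show ?thesis
    using p hardy_norm_nonneg[of p f] powr_less_mono2[of p "hardy_norm p f" "norm (f 0)"] by force
qed

text \<open>This is how kernels, their partners \<open>\<psi>\<close> and the backward shift of \<open>I\<close>, all bounded, get into
  the weighted space.\<close>

lemma bounded_mult_hardy_space:
  assumes h: "h holomorphic_on ball 0 1" and bdd: "bounded (h ` ball 0 1)"
    and g: "g \<in> hardy_space p" and p: "0 < p"
  shows "(\<lambda>z. h z * g z) \<in> hardy_space p"
proof -
  obtain M where M: "\<And>z. z \<in> ball 0 1 \<Longrightarrow> norm (h z) \<le> M"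
    using bdd unfolding bounded_image_iff by blast
  have "0 \<le> M"
    using M[of 0] norm_ge_zero[of "h 0"] by (simp del: norm_ge_zero)
  moreover have "(\<lambda>z. h z * g z) holomorphic_on ball 0 1"
    using h g by (intro holomorphic_intros) (auto simp: hardy_space_def)
  ultimately show ?thesis
    using M by (intro hardy_space_mono(1)[OF _ g p]) (auto simp: norm_mult intro: mult_right_mono)
qed

lemma bounded_in_weighted_hardy_space:
  assumes "h holomorphic_on ball 0 1" "bounded (h ` ball 0 1)" "g \<in> hardy_space p" "0 < p"
  shows "h \<in> weighted_hardy_space p g"
  using assms bounded_mult_hardy_space by (simp add: weighted_hardy_space_def)

section \<open>Difference quotients\<close>

definition difference_quotient :: "(complex \<Rightarrow> complex) \<Rightarrow> complex \<Rightarrow> complex \<Rightarrow> complex" where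
  "difference_quotient f a z = (if z = a then deriv f a else (f z - f a) / (z - a))"

lemma backward_shift_conv_difference_quotient: "backward_shift f = difference_quotient f 0"
  by (auto simp: backward_shift_def difference_quotient_def)

lemma holomorphic_difference_quotient:
  assumes "f holomorphic_on ball 0 1" "a \<in> ball 0 1"
  shows "difference_quotient f a holomorphic_on ball 0 1"
  using pole_lemma[OF assms(1), of a] assms(2) by (simp add: difference_quotient_def [abs_def])

text \<open>Away from \<open>a\<close> the denominator is bounded below; near \<open>a\<close> the quotient is continuous on a compact
  disk.\<close>

lemma bounded_difference_quotient:
  assumes f: "f holomorphic_on ball 0 1" and bdd: "bounded (f ` ball 0 1)" and a: "a \<in> ball 0 1"
  shows "bounded (difference_quotient f a ` ball 0 1)"
proof -
  define \<rho> where "\<rho> = (1 + norm a) / 2"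
  have \<rho>: "norm a < \<rho>" "\<rho> < 1"
    using a by (auto simp: \<rho>_def)
  obtain M where M: "\<And>z. z \<in> ball 0 1 \<Longrightarrow> norm (f z) \<le> M"
    using bdd unfolding bounded_image_iff by blast
  have "continuous_on (cball 0 \<rho>) (difference_quotient f a)"
    using holomorphic_difference_quotient[OF f a] \<rho>
    by (intro holomorphic_on_imp_continuous_on) (auto intro: holomorphic_on_subset)
  then have near: "bounded (difference_quotient f a ` cball 0 \<rho>)"
    by (intro compact_imp_bounded compact_continuous_image) auto
  have "norm (difference_quotient f a z) \<le> (M + M) / (\<rho> - norm a)" if z: "z \<in> ball 0 1 - cball 0 \<rho>" for z
  proof -
    have "\<rho> - norm a \<le> norm (z - a)"
      using z norm_triangle_ineq2[of z a] by auto
    moreover have "norm (f z - f a) \<le> M + M"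
      using M[of z] M[OF a] z norm_triangle_ineq4[of "f z" "f a"] by auto
    ultimately have "norm (f z - f a) / norm (z - a) \<le> (M + M) / (\<rho> - norm a)"
      using \<rho> order_trans[OF norm_ge_zero M[OF a]] by (intro frac_le) auto
    then show ?thesis
      using z \<rho> by (auto simp: difference_quotient_def norm_divide)
  qed
  then have "bounded (difference_quotient f a ` (ball 0 1 - cball 0 \<rho>))"
    unfolding bounded_image_iff by blast
  with near have "bounded (difference_quotient f a ` (cball 0 \<rho> \<union> (ball 0 1 - cball 0 \<rho>)))"
    by (simp only: image_Un bounded_Un)
  then show ?thesis
    by (rule bounded_subset) auto
qed

lemma backward_shift_scale:
  assumes "f holomorphic_on ball 0 1"
  shows "backward_shift (\<lambda>z. s * f z) z = s * backward_shift f z"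
proof -
  have "f field_differentiable at 0"
    using assms by (auto intro: holomorphic_on_imp_differentiable_at)
  then show ?thesis
    by (simp add: backward_shift_def deriv_cmult right_diff_distrib)
qed

section \<open>Reproducing kernels of the model space\<close>

text \<open>The unweighted model space for exponent 2 is a reproducing kernel Hilbert space, and this is its
  kernel at \<open>a\<close>.\<close>

definition model_kernel :: "(complex \<Rightarrow> complex) \<Rightarrow> complex \<Rightarrow> complex \<Rightarrow> complex" where
  "model_kernel I a z = (1 - cnj (I a) * I z) / (1 - cnj a * z)"

lemma norm_kernel_denominator:
  assumes "norm z \<le> 1"
  shows "1 - norm a \<le> norm (1 - cnj a * z)"
proof -
  have "norm (cnj a * z) \<le> norm a"
    using assms by (simp add: norm_mult mult_left_le)
  then show ?thesis
    using norm_triangle_ineq2[of 1 "cnj a * z"] by simp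
qed

lemma kernel_denominator_nonzero:
  assumes "a \<in> ball 0 1" "norm z \<le> 1"
  shows "1 - cnj a * z \<noteq> 0"
  using norm_kernel_denominator[OF assms(2), of a] assms(1) by auto

lemma holomorphic_model_kernel:
  assumes "I holomorphic_on ball 0 1" "a \<in> ball 0 1"
  shows "model_kernel I a holomorphic_on ball 0 1"
  unfolding model_kernel_def [abs_def]
  using assms kernel_denominator_nonzero[OF assms(2)] by (intro holomorphic_intros) auto

lemma bounded_model_kernel:
  assumes I: "\<And>z. z \<in> ball 0 1 \<Longrightarrow> norm (I z) \<le> 1" and a: "a \<in> ball 0 1"
  shows "bounded (model_kernel I a ` ball 0 1)"
proof -
  have "norm (model_kernel I a z) \<le> 2 / (1 - norm a)" if z: "z \<in> ball 0 1" for z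
  proof -
    have "norm (cnj (I a) * I z) \<le> 1"
      using I[OF a] I[OF z] by (simp add: norm_mult mult_le_one)
    then have "norm (1 - cnj (I a) * I z) \<le> 2"
      using norm_triangle_ineq4[of 1 "cnj (I a) * I z"] by simp
    with norm_kernel_denominator[of z a] z a show ?thesis
      unfolding model_kernel_def norm_divide by (intro frac_le) auto
  qed
  then show ?thesis
    unfolding bounded_image_iff by blast
qed

lemma kernel_almost_eigenvector:
  assumes I: "I holomorphic_on ball 0 1" and a: "a \<in> ball 0 1" and z: "z \<in> ball 0 1"
  shows "cnj a * model_kernel I a z - backward_shift (model_kernel I a) z
       = cnj (I a) * backward_shift I z"
proof (cases "z = 0")
  case True
  have "(I has_field_derivative deriv I 0) (at 0)"
    using I by (auto intro: holomorphic_derivI)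
  then have "((\<lambda>z. (1 - cnj (I a) * I z) / (1 - cnj a * z)) has_field_derivative
      cnj a * (1 - cnj (I a) * I 0) - cnj (I a) * deriv I 0) (at 0)"
    by (auto intro!: derivative_eq_intros simp: algebra_simps)
  then have "deriv (model_kernel I a) 0 = cnj a * (1 - cnj (I a) * I 0) - cnj (I a) * deriv I 0"
    unfolding model_kernel_def [abs_def] by (rule DERIV_imp_deriv)
  then show ?thesis
    by (simp add: True backward_shift_def model_kernel_def)
next
  case False
  have "1 - cnj a * z \<noteq> 0"
    using kernel_denominator_nonzero[OF a] z by simp
  with False show ?thesis
    by (simp add: backward_shift_def model_kernel_def divide_simps) (simp add: algebra_simps)
qed

text \<open>On the circle \<open>cnj z = 1 / z\<close> and \<open>cnj (I z) = 1 / I z\<close>, which turns \<open>I * cnj k\<^sub>a\<close> into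
  \<open>z * (I z - I a) / (z - a)\<close>; this is the function \<open>\<psi>\<close> required by the definition of the model
  space. The factor \<open>s\<close> serves to normalise the kernel.\<close>

lemma kernel_in_model_space:
  assumes inner: "inner_function I" and g: "g \<in> hardy_space p" and p: "0 < p" and a: "a \<in> ball 0 1"
  shows "(\<lambda>z. s * model_kernel I a z) \<in> model_space p g I"
proof -
  define \<psi> where "\<psi> = (\<lambda>z. cnj s * (z * difference_quotient I a z))"
  have hol: "I holomorphic_on ball 0 1" and le: "\<And>z. z \<in> ball 0 1 \<Longrightarrow> norm (I z) \<le> 1"
    and ae: "AE t in lborel. \<exists>l. has_radial_limit I (cis t) l \<and> norm l = 1"
    using inner by (auto simp: inner_function_def)
  have bddI: "bounded (I ` ball 0 1)"
    using le unfolding bounded_image_iff by blast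
  have "bounded ((\<lambda>z. s * model_kernel I a z) ` ball 0 1)"
    using bounded_linear_image[OF bounded_model_kernel[OF le a] bounded_linear_mult_right]
    by (simp add: image_image)
  then have kernel: "(\<lambda>z. s * model_kernel I a z) \<in> weighted_hardy_space p g"
    using holomorphic_model_kernel[OF hol a]
    by (intro bounded_in_weighted_hardy_space g p holomorphic_intros) auto
  have "bounded (\<psi> ` ball 0 1)"
  proof -
    obtain M where M: "\<And>z. z \<in> ball 0 1 \<Longrightarrow> norm (difference_quotient I a z) \<le> M"
      using bounded_difference_quotient[OF hol bddI a] unfolding bounded_image_iff by blast
    have "norm (\<psi> z) \<le> norm s * (1 * M)" if "z \<in> ball 0 1" for z
      unfolding \<psi>_def norm_mult complex_mod_cnj
      using that M[OF that] by (intro mult_left_mono mult_mono) auto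
    then show ?thesis
      unfolding bounded_image_iff by blast
  qed
  moreover have "\<psi> holomorphic_on ball 0 1"
    unfolding \<psi>_def using holomorphic_difference_quotient[OF hol a] by (intro holomorphic_intros)
  ultimately have \<psi>: "\<psi> \<in> weighted_hardy_space0 p g"
    using bounded_in_weighted_hardy_space g p
    by (simp add: weighted_hardy_space0_def) (simp add: \<psi>_def)
  have "\<exists>u b c. has_radial_limit (\<lambda>z. s * model_kernel I a z) (cis t) u \<and>
      has_radial_limit I (cis t) b \<and> has_radial_limit \<psi> (cis t) c \<and> u = b * cnj c"
    if ex: "\<exists>l. has_radial_limit I (cis t) l \<and> norm l = 1" for t
  proof -
    define w where "w = cis t"
    have w: "norm w = 1" "w * cnj w = 1"
      by (simp_all add: w_def cis_cnj cis_mult)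
    obtain b where b: "has_radial_limit I w b" and normb: "norm b = 1"
      using ex by (auto simp: w_def)
    then have bb: "b * cnj b = 1"
      by (simp flip: complex_norm_square)
    have wa: "w \<noteq> a"
      using w a by auto
    have limI: "((\<lambda>r. I (complex_of_real r * w)) \<longlongrightarrow> b) (at_left 1)"
      using b by (simp add: has_radial_limit_def)
    have limw: "((\<lambda>r. complex_of_real r * w) \<longlongrightarrow> w) (at_left 1)"
      by (auto intro!: tendsto_eq_intros)
    have den: "1 - cnj a * w \<noteq> 0"
      using kernel_denominator_nonzero[OF a] w by simp
    let ?u = "s * ((1 - cnj (I a) * b) / (1 - cnj a * w))"
    let ?c = "cnj s * (w * ((b - I a) / (w - a)))"
    have "has_radial_limit (\<lambda>z. s * model_kernel I a z) w ?u"
      unfolding has_radial_limit_def model_kernel_def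
      using den by (intro tendsto_intros limI limw) auto
    moreover have "has_radial_limit \<psi> w ?c"
    proof -
      have "((\<lambda>r. cnj s * (complex_of_real r * w *
          ((I (complex_of_real r * w) - I a) / (complex_of_real r * w - a)))) \<longlongrightarrow> ?c) (at_left 1)"
        using wa by (intro tendsto_intros limI limw) auto
      moreover have "\<forall>\<^sub>F r in at_left 1. complex_of_real r * w \<noteq> a"
        using tendsto_imp_eventually_ne[OF limw wa] .
      then have "\<forall>\<^sub>F r in at_left 1. cnj s * (complex_of_real r * w *
          ((I (complex_of_real r * w) - I a) / (complex_of_real r * w - a))) = \<psi> (complex_of_real r * w)"
        by eventually_elim (simp add: \<psi>_def difference_quotient_def)
      ultimately show ?thesis
        unfolding has_radial_limit_def by (rule Lim_transform_eventually)
    qed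
    moreover have "?u = b * cnj ?c"
    proof -
      have "cnj w - cnj a \<noteq> 0"
        using wa by (metis complex_cnj_cancel_iff right_minus_eq)
      moreover have "(1 - cnj (I a) * b) * (cnj w - cnj a)
          = b * (cnj w * (cnj b - cnj (I a))) * (1 - cnj a * w)"
        using w(2) bb by algebra
      ultimately have "(1 - cnj (I a) * b) / (1 - cnj a * w)
          = b * (cnj w * (cnj b - cnj (I a))) / (cnj w - cnj a)"
        using den by (simp add: frac_eq_eq)
      then show ?thesis
        by simp
    qed
    ultimately show ?thesis
      using b unfolding w_def by blast
  qed
  then have "AE t in lborel. \<exists>u b c. has_radial_limit (\<lambda>z. s * model_kernel I a z) (cis t) u \<and>
      has_radial_limit I (cis t) b \<and> has_radial_limit \<psi> (cis t) c \<and> u = b * cnj c"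
    using ae by (rule eventually_mono[rotated])
  with \<psi> kernel show ?thesis
    unfolding model_space_def by blast
qed

section \<open>Points of the spectrum\<close>

lemma inner_spectrum_approximable:
  assumes l: "l \<in> inner_spectrum I" and e: "0 < e"
  obtains a where "a \<in> ball 0 1" "norm (I a) < e" "norm (l - a) < e"
proof -
  have "Liminf (at l within ball 0 1) (\<lambda>z. ereal (norm (I z))) < ereal e"
    using l e by (simp add: inner_spectrum_def)
  then have "\<not> (\<forall>\<^sub>F z in at l within ball 0 1. ereal e \<le> ereal (norm (I z)))"
    using Liminf_bounded[of "ereal e" "\<lambda>z. ereal (norm (I z))" "at l within ball 0 1"] leD by metis
  then have freq: "\<exists>\<^sub>F z in at l within ball 0 1. norm (I z) < e"
    by (simp add: frequently_def not_less)
  have "\<forall>\<^sub>F z in at l within ball 0 1. z \<in> ball 0 1 \<and> norm (l - z) < e"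
    using e by (auto simp: eventually_at dist_norm norm_minus_commute)
  with freq have "\<exists>\<^sub>F z in at l within ball 0 1. (z \<in> ball 0 1 \<and> norm (l - z) < e) \<and> norm (I z) < e"
    by (rule frequently_eventually_conj)
  then show ?thesis
    using that frequently_ex by blast
qed

lemma outer_function_nonzero_at_origin:
  assumes "outer_function g"
  shows "g 0 \<noteq> 0"
  using assms by (auto simp: outer_function_def)

theorem proposition2:
  fixes p :: real and g I :: "complex \<Rightarrow> complex"
  assumes "1 < p"
    and "outer_function g"
    and "g \<in> hardy_space p"
    and "muckenhoupt_weight p (\<lambda>\<zeta>. norm (radial_limit g \<zeta>) powr p)"
    and "inner_function I"
  shows "cnj ` inner_spectrum I
           \<subseteq> approx_point_spectrum (model_space p g I) (weighted_hardy_norm p g) backward_shift"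
proof (rule image_subsetI)
  fix l assume l: "l \<in> inner_spectrum I"
  have p: "0 < p" "1 \<le> p" and g: "g \<in> hardy_space p"
    using assms by auto
  have I: "I holomorphic_on ball 0 1" "\<And>z. z \<in> ball 0 1 \<Longrightarrow> norm (I z) \<le> 1"
    using assms(5) by (auto simp: inner_function_def)
  \<comment> \<open>The offset 2 gives \<open>\<bar>I a\<^sub>n\<bar> \<le> 1/2\<close> for every \<open>n\<close>, which keeps the kernels away from 0 at the
    origin.\<close>
  define e :: "nat \<Rightarrow> real" where "e n = 1 / (2 + real n)" for n
  have e: "0 < e n" "e n \<le> 1 / 2" for n
    by (auto simp: e_def field_simps)
  have "\<exists>a. a \<in> ball 0 1 \<and> norm (I a) < e n \<and> norm (l - a) < e n" for n
    using inner_spectrum_approximable[OF l e(1)] by metis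
  then obtain a where a: "\<And>n. a n \<in> ball 0 1"
    and Ia: "\<And>n. norm (I (a n)) < e n" and la: "\<And>n. norm (l - a n) < e n"
    by metis
  define k where "k n = model_kernel I (a n)" for n
  define N where "N n = weighted_hardy_norm p g (k n)" for n
  define f where "f n = (\<lambda>z. complex_of_real (1 / N n) * k n z)" for n
  have k: "k n holomorphic_on ball 0 1" "(\<lambda>z. k n z * g z) \<in> hardy_space p" for n
    using holomorphic_model_kernel[OF I(1) a] bounded_model_kernel[OF I(2) a]
    by (auto simp: k_def intro!: bounded_mult_hardy_space g p)
  have g0: "g 0 \<noteq> 0"
    using assms(2) by (rule outer_function_nonzero_at_origin)
  have N: "norm (g 0) / 2 \<le> N n" for n
  proof -
    have "norm (cnj (I (a n)) * I 0) \<le> 1 / 2"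
      using Ia[of n] e(2)[of n] I(2)[of 0] mult_mono[of "norm (I (a n))" "1/2" "norm (I 0)" 1]
      by (simp add: norm_mult)
    then have "1 / 2 \<le> norm (k n 0)"
      using norm_triangle_ineq2[of 1 "cnj (I (a n)) * I 0"] by (simp add: k_def model_kernel_def)
    then have "1 / 2 * norm (g 0) \<le> norm (k n 0 * g 0)"
      unfolding norm_mult by (intro mult_right_mono) auto
    also have "\<dots> \<le> N n"
      using norm_at_origin_le_hardy_norm[OF k(2) p(1)] by (simp add: N_def weighted_hardy_norm_def)
    finally show ?thesis
      by simp
  qed
  have Npos: "0 < N n" for n
    using N[of n] g0 by (smt (verit) zero_less_norm_iff half_gt_zero)
  have fg: "(\<lambda>z. f n z * g z) \<in> hardy_space p" "hardy_norm p (\<lambda>z. f n z * g z) = 1" for n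
    using hardy_space_scale[OF k(2) p(1), of "complex_of_real (1 / N n)" n] Npos[of n]
    by (auto simp: f_def mult.assoc N_def weighted_hardy_norm_def norm_divide)
  have shift: "(\<lambda>z. backward_shift I z * g z) \<in> hardy_space p"
    unfolding backward_shift_conv_difference_quotient
    using I by (intro bounded_mult_hardy_space g p holomorphic_difference_quotient
        bounded_difference_quotient) (auto simp: bounded_image_iff intro!: exI[of _ 1])
  define C where "C = hardy_norm p (\<lambda>z. backward_shift I z * g z)"
  have C: "0 \<le> C"
    by (simp add: C_def hardy_norm_nonneg)
  \<comment> \<open>\<open>(cnj l - B) f\<^sub>n\<close> splits into the error of replacing \<open>cnj a\<^sub>n\<close> by \<open>cnj l\<close> and the small
    multiple of \<open>B I\<close> produced by the kernel.\<close>
  let ?d = "\<lambda>n z. cnj l * f n z - backward_shift (f n) z"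
  have bound: "weighted_hardy_norm p g (?d n) \<le> 4 * (1 + 2 / norm (g 0) * C) * e n" for n
  proof -
    define u where "u = (\<lambda>z. cnj (l - a n) * (f n z * g z))"
    define v where "v = (\<lambda>z. cnj (I (a n)) / complex_of_real (N n) * (backward_shift I z * g z))"
    note u = hardy_space_scale[OF fg(1) p(1), of "cnj (l - a n)" n, folded u_def]
    note v = hardy_space_scale[OF shift p(1), of "cnj (I (a n)) / complex_of_real (N n)", folded v_def]
    have decomp: "?d n z * g z = u z + v z" if z: "z \<in> ball 0 1" for z
    proof -
      have "backward_shift (f n) z = complex_of_real (1 / N n) * backward_shift (k n) z"
        unfolding f_def by (rule backward_shift_scale[OF k(1)])
      then have "?d n z = cnj (l - a n) * f n z
          + 1 / N n * (cnj (a n) * k n z - backward_shift (k n) z)"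
        by (simp add: f_def diff_divide_distrib algebra_simps)
      also have "\<dots> = cnj (l - a n) * f n z + cnj (I (a n)) / N n * backward_shift I z"
        using kernel_almost_eigenvector[OF I(1) a z] by (simp add: k_def)
      finally show ?thesis
        by (simp add: u_def v_def algebra_simps)
    qed
    have "integral_mean p (\<lambda>z. ?d n z * g z) r = integral_mean p (\<lambda>z. u z + v z) r"
      if "r \<in> {0..<1}" for r
      using decomp[OF circle_point_in_disk[OF that]] by (simp add: integral_mean_def)
    then have "weighted_hardy_norm p g (?d n) = hardy_norm p (\<lambda>z. u z + v z)"
      unfolding weighted_hardy_norm_def hardy_norm_def by (metis (no_types, lifting) SUP_cong)
    also have "\<dots> \<le> 4 * (hardy_norm p u + hardy_norm p v)"
      using u(1) v(1) p(2) by (rule hardy_norm_add)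
    also have "hardy_norm p u \<le> e n"
      unfolding u(2) complex_mod_cnj fg(2) using la[of n] by simp
    also have "hardy_norm p v \<le> e n / (norm (g 0) / 2) * C"
    proof -
      have "norm (I (a n)) / N n \<le> e n / (norm (g 0) / 2)"
        using Ia[of n] N[of n] g0 e(1)[of n] by (intro frac_le) auto
      with C Npos[of n] show ?thesis
        unfolding v(2) C_def[symmetric] by (intro mult_right_mono) (auto simp: norm_divide)
    qed
    finally show ?thesis
      by (simp add: field_simps)
  qed
  have "e \<longlonglongrightarrow> 0"
    unfolding e_def [abs_def] by real_asymp
  then have lim: "(\<lambda>n. 4 * (1 + 2 / norm (g 0) * C) * e n) \<longlonglongrightarrow> 0"
    by (intro tendsto_mult_right_zero)
  have "(\<lambda>n. weighted_hardy_norm p g (?d n)) \<longlonglongrightarrow> 0"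
    by (rule tendsto_sandwich[OF _ _ tendsto_const lim])
       (use bound in \<open>auto simp: weighted_hardy_norm_def hardy_norm_nonneg\<close>)
  moreover have "f n \<in> model_space p g I" for n
    unfolding f_def k_def by (rule kernel_in_model_space[OF assms(5) g p(1) a])
  ultimately show "cnj l \<in> approx_point_spectrum (model_space p g I) (weighted_hardy_norm p g) backward_shift"
    using fg(2) unfolding approx_point_spectrum_def by (auto simp: weighted_hardy_norm_def)
qed

end
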